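(* Let $n\geq 2$ and $j\geq 2$ be integers. If $j$ is even, then \[ m_j(K_j,K_{1,n})=\Big\lfloor \frac{2(n-1)(j-1)}{j}\Big\rfloor+1 . \] If $j$ is odd, then \[ m_j(K_j,K_{1,n})=\Big\lfloor \frac{2(n-1)(j-2)}{j-1}\Big\rfloor+1 . \]
   Context: All graphs are simple; $K_j$ is the complete graph on $j$ vertices and $K_{1,n}$ is the star with $n+1$ vertices ($n$ leaves). For integers $j\geq 2$ and $t\geq 1$, $K_{j\times t}$ denotes the complete multipartite graph with $j$ parts, each of size $t$. For graphs $H$ and $G$, the size multipartite Ramsey number $m_j(H,G)$ is the smallest natural number $t$ such that every coloring of the edges of $K_{j\times t}$ with two colors red and blue contains a red copy of $H$ or a blue copy of $G$ as a subgraph. *)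

theory Defs
  imports Complex_Main "HOL-Library.Extended_Nat"
begin

text \<open>A simple graph is a pair of a vertex set and a set of two-element subsets of it.\<close>

type_synonym 'a graph = "'a set \<times> 'a set set"

abbreviation verts :: "'a graph \<Rightarrow> 'a set" where "verts \<equiv> fst"
abbreviation edges :: "'a graph \<Rightarrow> 'a set set" where "edges \<equiv> snd"

definition simple_graph :: "'a graph \<Rightarrow> bool" where
  "simple_graph G \<longleftrightarrow> (\<forall>e\<in>edges G. e \<subseteq> verts G \<and> card e = 2)"

definition subgraph :: "'a graph \<Rightarrow> 'a graph \<Rightarrow> bool" where
  "subgraph H G \<longleftrightarrow> simple_graph H \<and> verts H \<subseteq> verts G \<and> edges H \<subseteq> edges G"

definition isomorphic :: "'a graph \<Rightarrow> 'b graph \<Rightarrow> bool" where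
  "isomorphic G H \<longleftrightarrow> (\<exists>f. bij_betw f (verts G) (verts H) \<and> edges H = (\<lambda>e. f ` e) ` edges G)"

definition contains_copy :: "'a graph \<Rightarrow> 'b graph \<Rightarrow> bool" where
  "contains_copy G H \<longleftrightarrow> (\<exists>H'. subgraph H' G \<and> isomorphic H H')"

definition complete_graph :: "nat \<Rightarrow> nat graph" where
  "complete_graph j = ({..<j}, {{u, v} | u v. u < j \<and> v < j \<and> u \<noteq> v})"

text \<open>The centre is \<open>0\<close>, the leaves are \<open>1, \<dots>, n\<close>.\<close>

definition star :: "nat \<Rightarrow> nat graph" where
  "star n = ({0..n}, {{0, i} | i. 1 \<le> i \<and> i \<le> n})"

text \<open>The first component of a vertex is its part.\<close>

definition complete_multipartite :: "nat \<Rightarrow> nat \<Rightarrow> (nat \<times> nat) graph" where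
  "complete_multipartite j t =
     ({..<j} \<times> {..<t},
      {{u, v} | u v. u \<in> {..<j} \<times> {..<t} \<and> v \<in> {..<j} \<times> {..<t} \<and> fst u \<noteq> fst v})"

datatype colour = Red | Blue

definition colour_class :: "'a graph \<Rightarrow> ('a set \<Rightarrow> colour) \<Rightarrow> colour \<Rightarrow> 'a graph" where
  "colour_class G c k = (verts G, {e \<in> edges G. c e = k})"

definition arrows :: "'a graph \<Rightarrow> 'b graph \<Rightarrow> 'c graph \<Rightarrow> bool" where
  "arrows F H G \<longleftrightarrow>
     (\<forall>c. contains_copy (colour_class F c Red) H \<or> contains_copy (colour_class F c Blue) G)"

text \<open>The infimum in \<^typ>\<open>enat\<close> is the least element of a nonempty set, and \<open>\<infinity>\<close> if no such
  \<open>t\<close> exists; an equation with a finite value thus includes existence.\<close>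

definition multipartite_ramsey :: "nat \<Rightarrow> 'a graph \<Rightarrow> 'b graph \<Rightarrow> enat" where
  "multipartite_ramsey j H G = Inf {enat t | t. t \<ge> 1 \<and> arrows (complete_multipartite j t) H G}"

end

theory Submission
  imports Defs
begin

text \<open>Put \<open>d = n - 1\<close> and let \<open>m\<close> be the integer part of \<open>j / 2\<close>; both cases claim that the threshold is
  \<open>t > (2 m - 1) d / m\<close>. A colouring without a blue star is a blue graph of maximum degree at most \<open>d\<close>, and a
  red \<open>K\<^sub>j\<close> is an independent transversal of it.

  For the upper bound, Haxell's method turns the absence of a transversal into a set \<open>S\<close> of classes
  dominated by at most \<open>2 |S| - 2\<close> vertices \<open>D\<close>, where \<open>D\<close> provides partial transversals on \<open>S\<close>. Such a pair is
  combined with a vertex \<open>v\<close> outside \<open>S\<close> not adjacent to \<open>D\<close>, and \<open>(S, D, v)\<close> with \<open>|S| \<le> m\<close> is chosen to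
  minimise the number of vertices of \<open>S\<close> that \<open>D \<union> {v}\<close> leaves undominated. An undominated vertex \<open>u\<close> gives a
  partial transversal through \<open>u\<close> and \<open>v\<close>; applying Haxell's method to the remaining vertices gives a
  triple \<open>(S', D', u)\<close>, and counting the degrees of \<open>D \<union> {v}\<close> in \<open>S\<close> and \<open>S'\<close> shows that fewer vertices of \<open>S'\<close> are
  undominated. This generalises the maximum-degree argument for three classes.

  For the lower bound, the blue graph is a union of complete bipartite graphs that encodes an
  unsatisfiable formula with \<open>2 m\<close> clauses and \<open>2 m - 1\<close> variables; when \<open>j\<close> is odd the last class has no
  blue edges.\<close>

section \<open>Dominated subfamilies\<close>

locale irreflexive_graph =
  fixes adj :: "'v \<Rightarrow> 'v \<Rightarrow> bool"
  assumes adj_sym: "adj x y \<Longrightarrow> adj y x"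
    and adj_irrefl: "\<not> adj x x"
begin

definition nbh :: "'v set \<Rightarrow> 'v set" where
  "nbh D = {y. \<exists>x\<in>D. adj x y}"

definition transversal :: "('i \<Rightarrow> 'v set) \<Rightarrow> 'i set \<Rightarrow> ('i \<Rightarrow> 'v) \<Rightarrow> bool" where
  "transversal V J f \<longleftrightarrow> (\<forall>i\<in>J. f i \<in> V i) \<and> (\<forall>i\<in>J. \<forall>j\<in>J. \<not> adj (f i) (f j))"

text \<open>Every vertex not dominated by a flexible \<open>D\<close> extends to a transversal of \<open>S\<close> inside \<open>D\<close>. The
  standard example is the vertex set of an induced matching that forms a spanning tree on the classes.\<close>

definition flexible :: "('i \<Rightarrow> 'v set) \<Rightarrow> 'i set \<Rightarrow> 'v set \<Rightarrow> bool" where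
  "flexible V S D \<longleftrightarrow> (\<forall>i\<in>S. \<exists>g. transversal (\<lambda>i. V i \<inter> D) (S - {i}) g)"

lemma nbh_Un: "nbh (A \<union> B) = nbh A \<union> nbh B"
  by (auto simp: nbh_def)

lemma not_adj_nbh: "x \<in> D \<Longrightarrow> y \<notin> nbh D \<Longrightarrow> \<not> adj x y \<and> \<not> adj y x"
  using adj_sym by (auto simp: nbh_def)

lemma transversal_insert:
  assumes f: "transversal V A f" and x: "x \<in> V c" and nx: "\<And>i. i \<in> A \<Longrightarrow> i \<noteq> c \<Longrightarrow> \<not> adj x (f i)"
  shows "transversal V (insert c A) (f(c := x))"
proof -
  have "\<not> adj (f i) x" if "i \<in> A" "i \<noteq> c" for i using nx that adj_sym by blast
  then show ?thesis using f x nx adj_irrefl by (auto simp: transversal_def)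
qed

lemma transversal_subset: "transversal V A f \<Longrightarrow> B \<subseteq> A \<Longrightarrow> transversal V B f"
  by (auto simp: transversal_def)

lemma transversal_mono:
  "transversal V A f \<Longrightarrow> (\<And>i. i \<in> A \<Longrightarrow> V i \<subseteq> W i) \<Longrightarrow> transversal W A f"
  by (auto simp: transversal_def)

text \<open>Haxell's argument, organised as an induction that contracts a star. Choose \<open>v\<close> in the root class
  \<open>c\<close> and a transversal \<open>f\<close> of the other classes with the fewest possible neighbours of \<open>v\<close> on it, and let
  \<open>D0\<close> consist of \<open>v\<close> and these neighbours. The classes met by \<open>D0\<close> are merged into one, from which
  (as from all the others) everything dominated by \<open>D0\<close> is deleted; minimality shows that the contracted
  family has no transversal either. A star with a single edge keeps the family flexible, and a larger
  star saves a vertex in the count of \<open>D\<close>.\<close>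

lemma dominated_subfamily_rooted:
  assumes "finite J" "c \<in> J" "\<nexists>f. transversal W J f" "transversal W (J - {c}) f0"
  shows "\<exists>S D. S \<subseteq> J \<and> c \<in> S \<and> finite D \<and> D \<subseteq> \<Union>(W ` S) \<and> \<Union>(W ` S) \<subseteq> nbh D \<and>
    (card D + 2 \<le> 2 * card S \<and> flexible W S D \<or> card D + 3 \<le> 2 * card S)"
  using assms
proof (induction "card J" arbitrary: J W f0 rule: less_induct)
  case less
  show ?case
  proof (cases "W c = {}")
    case True
    then show ?thesis
      using less.prems by (intro exI[of _ "{c}"] exI[of _ "{}"]) (auto simp: flexible_def transversal_def)
  next
    case False
    define Q where "Q k \<longleftrightarrow> (\<exists>v f. v \<in> W c \<and> transversal W (J - {c}) f \<and> 
        card {i \<in> J - {c}. adj v (f i)} = k)" for k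
    have "\<exists>k. Q k" using False less.prems(4) unfolding Q_def by blast
    then have "Q (LEAST k. Q k)" by (rule LeastI_ex)
    then obtain v f where v: "v \<in> W c" and f: "transversal W (J - {c}) f"
      and k: "card {i \<in> J - {c}. adj v (f i)} = (LEAST k. Q k)"
      unfolding Q_def by blast
    define K where "K = {i \<in> J - {c}. adj v (f i)}"
    have kmin: "card K \<le> card {i \<in> J - {c}. adj v (h i)}" if "transversal W (J - {c}) h" for h
      using that v k unfolding K_def by (metis (mono_tags, lifting) Least_le Q_def)
    have KJ: "K \<subseteq> J" "c \<notin> K" by (auto simp: K_def)
    have finK: "finite K" using KJ less.prems(1) finite_subset by blast
    have Kne: "K \<noteq> {}"
    proof
      assume "K = {}"
      then have "transversal W (insert c (J - {c})) (f(c := v))"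
        using f v by (intro transversal_insert) (auto simp: K_def)
      then show False using less.prems(2,3) by (metis insert_Diff)
    qed
    define D0 where "D0 = insert v (f ` K)"
    have fW: "f i \<in> W i" if "i \<in> J - {c}" for i using f that by (auto simp: transversal_def)
    have fi: "\<not> adj (f i) (f j)" if "i \<in> J - {c}" "j \<in> J - {c}" for i j
      using f that by (auto simp: transversal_def)
    \<comment> \<open>The merged class keeps the index \<open>c\<close>, so the contracted family is
      rooted at \<open>c\<close> again.\<close>
    define J' where "J' = J - K"
    define W' where "W' i = (if i = c then \<Union>(W ` insert c K) else W i) - nbh D0" for i
    have cJ': "c \<in> J'" using less.prems(2) KJ by (auto simp: J'_def)
    have "J' \<subset> J" using Kne KJ by (auto simp: J'_def)
    then have smaller: "card J' < card J" by (simp add: less.prems(1) psubset_card_mono)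
    have finJ': "finite J'" using less.prems(1) by (simp add: J'_def)
    have f': "transversal W' (J' - {c}) f"
      unfolding transversal_def
    proof (intro conjI ballI)
      fix i assume i: "i \<in> J' - {c}"
      then have "\<not> adj v (f i)" by (auto simp: J'_def K_def)
      moreover have "\<not> adj (f k) (f i)" if "k \<in> K" for k using fi i that by (auto simp: J'_def K_def)
      ultimately have "f i \<notin> nbh D0" by (auto simp: nbh_def D0_def)
      then show "f i \<in> W' i" using i fW by (auto simp: W'_def J'_def)
    next
      fix i j assume "i \<in> J' - {c}" "j \<in> J' - {c}"
      then show "\<not> adj (f i) (f j)" using fi by (auto simp: J'_def)
    qed
    have nog: "\<nexists>g. transversal W' J' g"
    proof
      assume "\<exists>g. transversal W' J' g"
      then obtain g where g: "transversal W' J' g" by blast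
      have gD0: "\<And>i. i \<in> J' \<Longrightarrow> g i \<notin> nbh D0" using g by (auto simp: transversal_def W'_def)
      have gg: "\<And>i j. i \<in> J' \<Longrightarrow> j \<in> J' \<Longrightarrow> \<not> adj (g i) (g j)" using g by (auto simp: transversal_def)
      have gW: "\<And>i. i \<in> J' \<Longrightarrow> i \<noteq> c \<Longrightarrow> g i \<in> W i" using g by (auto simp: transversal_def W'_def)
      \<comment> \<open>A vertex \<open>g c\<close> of \<open>W c\<close> would complete
        \<open>h\<close> to a transversal of \<open>J\<close>. A vertex \<open>g c\<close> of
        \<open>W l\<close> with \<open>l\<close> in \<open>K\<close> would replace
        \<open>f l\<close> and leave fewer neighbours of \<open>v\<close> than the minimum.\<close>
      define h where "h i = (if i \<in> K then f i else g i)" for i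
      have h: "transversal W (J - {c}) h"
        unfolding transversal_def
      proof (intro conjI ballI)
        fix i assume "i \<in> J - {c}"
        then show "h i \<in> W i" using fW gW by (auto simp: h_def J'_def)
      next
        fix i j assume "i \<in> J - {c}" "j \<in> J - {c}"
        then show "\<not> adj (h i) (h j)"
          using fi gg not_adj_nbh[of "f i" D0 "g j"] not_adj_nbh[of "f j" D0 "g i"] gD0
          by (auto simp: h_def J'_def D0_def)
      qed
      have gc: "\<not> adj (g c) (h i)" if "i \<in> J - {c}" for i
        using that gg cJ' not_adj_nbh[of "f i" D0 "g c"] gD0[OF cJ'] by (auto simp: h_def D0_def J'_def)
      have "g c \<in> \<Union>(W ` insert c K)" using g cJ' by (auto simp: transversal_def W'_def)
      then consider "g c \<in> W c" | l where "l \<in> K" "g c \<in> W l" by blast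
      then show False
      proof cases
        case 1
        have "transversal W (insert c (J - {c})) (h(c := g c))"
          by (rule transversal_insert[OF h 1]) (use gc in auto)
        then show False using less.prems(2,3) by (metis insert_Diff)
      next
        case 2
        have l: "insert l (J - {c}) = J - {c}" using 2 KJ by auto
        have "transversal W (insert l (J - {c})) (h(l := g c))"
          by (rule transversal_insert[OF h 2(2)]) (use gc in auto)
        then have "card K \<le> card {i \<in> J - {c}. adj v ((h(l := g c)) i)}" using kmin l by metis
        moreover have "{i \<in> J - {c}. adj v ((h(l := g c)) i)} \<subseteq> K - {l}"
          using gD0 cJ' not_adj_nbh[of v D0] by (auto simp: h_def D0_def J'_def)
        moreover have "card (K - {l}) < card K" using finK 2 by (metis card_Diff1_less)
        ultimately show False using finK by (meson card_mono finite_Diff not_le le_trans)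
      qed
    qed
    from less.hyps[OF smaller finJ' cJ' nog f'] obtain S' D' where
      S': "S' \<subseteq> J'" "c \<in> S'" and D': "finite D'" "D' \<subseteq> \<Union>(W' ` S')" "\<Union>(W' ` S') \<subseteq> nbh D'" and
      alt: "card D' + 2 \<le> 2 * card S' \<and> flexible W' S' D' \<or> card D' + 3 \<le> 2 * card S'" by blast
    define S where "S = S' \<union> K"
    define D where "D = D0 \<union> D'"
    have finS': "finite S'" using S' finJ' finite_subset by blast
    have cardS: "card S = card S' + card K" unfolding S_def
      using finS' finK S'(1) by (intro card_Un_disjoint) (auto simp: J'_def)
    have "card D0 \<le> Suc (card K)" unfolding D0_def
      using card_image_le[OF finK, of f] finK by (simp add: card_insert_if)
    then have cardD: "card D \<le> card D' + card K + 1" unfolding D_def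
      using card_Un_le[of D0 D'] by simp
    have cardK: "card K > 0" using finK Kne by (simp add: card_gt_0_iff)
    have D'D0: "\<And>x. x \<in> D' \<Longrightarrow> x \<notin> nbh D0" using D' by (auto simp: W'_def)
    have WS: "\<Union>(W' ` S') \<subseteq> \<Union>(W ` S)" using S' by (auto simp: W'_def S_def)
    have "f i \<in> \<Union>(W ` S)" if "i \<in> K" for i using fW[of i] that KJ by (auto simp: S_def)
    moreover have "v \<in> \<Union>(W ` S)" using v S' by (auto simp: S_def)
    ultimately have "D0 \<subseteq> \<Union>(W ` S)" by (auto simp: D0_def)
    then have DW: "D \<subseteq> \<Union>(W ` S)" using D' WS by (auto simp: D_def)
    have "\<Union>(W ` S) \<subseteq> \<Union>(W' ` S') \<union> nbh D0"
    proof
      fix x assume "x \<in> \<Union>(W ` S)"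
      then obtain i where i: "i \<in> S" "x \<in> W i" by blast
      show "x \<in> \<Union>(W' ` S') \<union> nbh D0"
      proof (cases "i = c \<or> i \<in> K")
        case True then show ?thesis using i S' by (auto simp: W'_def)
      next
        case False then show ?thesis using i S' by (auto simp: W'_def S_def)
      qed
    qed
    then have dom: "\<Union>(W ` S) \<subseteq> nbh D" using D' by (auto simp: D_def nbh_Un)
    \<comment> \<open>If \<open>b\<close> or \<open>c\<close> is omitted, the other one of the two
      takes its end of the edge between \<open>v\<close> and \<open>f b\<close>. Otherwise
      \<open>D'\<close> supplies a vertex \<open>g c\<close> of the merged class, and the class
      among \<open>b\<close> and \<open>c\<close> that it leaves free takes its end of the
      edge.\<close>
    have flex: "flexible W S D" if K1: "card K = 1" and F: "flexible W' S' D'"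
    proof -
      obtain b where b: "K = {b}" using K1 card_1_singletonE by blast
      have D0: "D0 = {v, f b}" by (simp add: D0_def b)
      have bc: "b \<noteq> c" "b \<notin> S'" "b \<in> J" using KJ b S' by (auto simp: J'_def)
      have fb: "f b \<in> W b" using fW bc by auto
      have nv: "\<not> adj v x" and nf: "\<not> adj (f b) x" if "x \<in> D'" for x
        using D'D0[OF that] by (auto simp: D0 nbh_def)
      have nv': "\<not> adj x v" if "x \<in> D'" for x using nv that adj_sym by blast
      have W'W: "W' i \<inter> D' \<subseteq> W i \<inter> D" if "i \<noteq> c" for i using that by (auto simp: W'_def D_def)
      show ?thesis
        unfolding flexible_def
      proof
        fix i assume i: "i \<in> S"
        show "\<exists>g. transversal (\<lambda>i. W i \<inter> D) (S - {i}) g"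
        proof (cases "i = c \<or> i = b")
          case True
          from F S' obtain g where g: "transversal (\<lambda>i. W' i \<inter> D') (S' - {c}) g"
            by (auto simp: flexible_def)
          then have g1: "transversal (\<lambda>i. W i \<inter> D) (S' - {c}) g"
            by (rule transversal_mono) (use W'W in auto)
          have gD: "\<And>k. k \<in> S' - {c} \<Longrightarrow> g k \<in> D'" using g by (auto simp: transversal_def)
          from True show ?thesis
          proof
            assume ic: "i = c"
            have "transversal (\<lambda>i. W i \<inter> D) (insert b (S' - {c})) (g(b := f b))"
              by (rule transversal_insert[OF g1]) (use fb gD nf in \<open>auto simp: D_def D0\<close>)
            moreover have "S - {i} = insert b (S' - {c})" using ic bc by (auto simp: S_def b)
            ultimately show ?thesis by auto
          next
            assume ib: "i = b"
            have "transversal (\<lambda>i. W i \<inter> D) (insert c (S' - {c})) (g(c := v))"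
              by (rule transversal_insert[OF g1]) (use v gD nv in \<open>auto simp: D_def D0\<close>)
            moreover have "S - {i} = insert c (S' - {c})" using ib bc S' by (auto simp: S_def b)
            ultimately show ?thesis by auto
          qed
        next
          case False
          then have i': "i \<in> S'" "i \<noteq> c" "i \<noteq> b" using i by (auto simp: S_def b)
          with F obtain g where g: "transversal (\<lambda>i. W' i \<inter> D') (S' - {i}) g"
            by (auto simp: flexible_def)
          have gD: "\<And>k. k \<in> S' - {i} \<Longrightarrow> g k \<in> D'" using g by (auto simp: transversal_def)
          have g1: "transversal (\<lambda>i. W i \<inter> D) (S' - {i} - {c}) g"
            by (rule transversal_mono[OF transversal_subset[OF g]]) (use W'W in auto)
          have gg: "\<not> adj (g k) (g l)" if "k \<in> S' - {i}" "l \<in> S' - {i}" for k l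
            using g that by (auto simp: transversal_def)
          have cS: "c \<in> S' - {i}" using S' i' by auto
          have eq: "S - {i} = insert b (insert c (S' - {i} - {c}))" using i' bc S' by (auto simp: S_def b)
          have "g c \<in> W' c" using g cS by (auto simp: transversal_def)
          then consider "g c \<in> W c" | "g c \<in> W b" by (auto simp: W'_def b)
          then show ?thesis
          proof cases
            case 1
            have "transversal (\<lambda>i. W i \<inter> D) (insert c (S' - {i} - {c})) (g(c := g c))"
              by (rule transversal_insert[OF g1]) (use 1 gD gg cS in \<open>auto simp: D_def\<close>)
            then have "transversal (\<lambda>i. W i \<inter> D) (insert b (insert c (S' - {i} - {c}))) ((g(c := g c))(b := f b))"
              by (rule transversal_insert) (use fb gD nf cS in \<open>auto simp: D_def D0\<close>)
            then show ?thesis using eq by auto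
          next
            case 2
            have "transversal (\<lambda>i. W i \<inter> D) (insert c (S' - {i} - {c})) (g(c := v))"
              by (rule transversal_insert[OF g1]) (use v gD nv in \<open>auto simp: D_def D0\<close>)
            then have "transversal (\<lambda>i. W i \<inter> D) (insert b (insert c (S' - {i} - {c}))) ((g(c := v))(b := g c))"
              by (rule transversal_insert) (use 2 gD gg cS nv' in \<open>auto simp: D_def\<close>)
            then show ?thesis using eq by auto
          qed
        qed
      qed
    qed
    \<comment> \<open>A star with k edges adds k to \<open>card S\<close> and at most k + 1 to
      \<open>card D\<close>, so the slack grows by at least k - 1.\<close>
    have "card D + 2 \<le> 2 * card S \<and> flexible W S D \<or> card D + 3 \<le> 2 * card S"
    proof (cases "card K = 1")
      case True
      then show ?thesis using alt flex cardS cardD by auto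
    next
      case False
      then have "card K \<ge> 2" using cardK by simp
      then show ?thesis using alt cardS cardD by auto
    qed
    moreover have "S \<subseteq> J" using S' KJ by (auto simp: S_def J'_def)
    moreover have "c \<in> S" using S' by (simp add: S_def)
    moreover have "finite D" using D' finK by (simp add: D_def D0_def)
    ultimately show ?thesis using DW dom by blast
  qed
qed

text \<open>Classes are dropped until some class \<open>c\<close> is left whose removal admits a
  transversal, as the rooted version requires.\<close>

lemma dominated_subfamily:
  assumes "finite J" "\<nexists>f. transversal W J f"
  shows "\<exists>S D. S \<subseteq> J \<and> S \<noteq> {} \<and> finite D \<and> D \<subseteq> \<Union>(W ` S) \<and> \<Union>(W ` S) \<subseteq> nbh D \<and>
    (card D + 2 \<le> 2 * card S \<and> flexible W S D \<or> card D + 3 \<le> 2 * card S)"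
  using assms
proof (induction J rule: finite_psubset_induct)
  case (psubset J)
  have "J \<noteq> {}" using psubset.prems by (auto simp: transversal_def)
  then obtain c where c: "c \<in> J" by blast
  show ?case
  proof (cases "\<exists>f. transversal W (J - {c}) f")
    case True
    then obtain f0 where "transversal W (J - {c}) f0" by blast
    from dominated_subfamily_rooted[OF psubset.hyps(1) c psubset.prems this] show ?thesis by blast
  next
    case False
    have "J - {c} \<subset> J" using c by blast
    from psubset.IH[OF this False] show ?thesis by (meson Diff_subset subset_trans)
  qed
qed

section \<open>Domination of the classes outside a partial transversal\<close>

lemma nbh_disjoint:
  assumes "D \<inter> nbh A = {}" "x \<in> A"
  shows "x \<notin> nbh D"
proof
  assume "x \<in> nbh D"
  then obtain y where y: "y \<in> D" "adj y x" by (auto simp: nbh_def)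
  then have "y \<in> nbh A" using assms(2) adj_sym unfolding nbh_def by blast
  then show False using assms(1) y by blast
qed

lemma flexible_mono:
  assumes "flexible V S D" "\<And>i. i \<in> S \<Longrightarrow> V i \<subseteq> W i"
  shows "flexible W S D"
  unfolding flexible_def
proof
  fix i assume "i \<in> S"
  then obtain g where "transversal (\<lambda>i. V i \<inter> D) (S - {i}) g"
    using assms(1) by (auto simp: flexible_def)
  then have "transversal (\<lambda>i. W i \<inter> D) (S - {i}) g"
    by (rule transversal_mono) (use assms(2) in auto)
  then show "\<exists>g. transversal (\<lambda>i. W i \<inter> D) (S - {i}) g" by blast
qed

lemma transversal_Un:
  assumes f: "transversal V A f" and g: "transversal V B g"
    and fg: "\<And>i j. i \<in> A \<Longrightarrow> j \<in> B \<Longrightarrow> \<not> adj (f i) (g j)"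
  shows "transversal V (A \<union> B) (\<lambda>i. if i \<in> A then f i else g i)"
proof -
  have "\<not> adj (g j) (f i)" if "i \<in> A" "j \<in> B" for i j using fg that adj_sym by blast
  then show ?thesis using f g fg by (auto simp: transversal_def)
qed

text \<open>Delete the neighbours of the chosen vertices \<open>f i\<close> from the classes outside
  \<open>A\<close>. A transversal of what is left would extend \<open>f\<close> to all of
  \<open>I\<close>.\<close>

lemma dominated_complement:
  assumes fin: "finite I" and noT: "\<nexists>f. transversal V I f"
    and f: "transversal V A f" and A: "A \<subseteq> I"
  shows "\<exists>S D. S \<subseteq> I - A \<and> S \<noteq> {} \<and> finite D \<and> D \<subseteq> \<Union>(V ` S) \<and> D \<inter> nbh (f ` A) = {} \<and>
    \<Union>(V ` S) \<subseteq> nbh D \<union> nbh (f ` A) \<and>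
    (card D + 2 \<le> 2 * card S \<and> flexible V S D \<or> card D + 3 \<le> 2 * card S)"
proof -
  define W where "W i = V i - nbh (f ` A)" for i
  have "\<nexists>g. transversal W (I - A) g"
  proof
    assume "\<exists>g. transversal W (I - A) g"
    then obtain g where g: "transversal W (I - A) g" by blast
    have gV: "transversal V (I - A) g"
      by (rule transversal_mono[OF g]) (auto simp: W_def)
    have "\<not> adj (f i) (g j)" if "i \<in> A" "j \<in> I - A" for i j
    proof -
      have "g j \<notin> nbh (f ` A)" using g that by (auto simp: transversal_def W_def)
      then show ?thesis using that by (simp add: nbh_def)
    qed
    from transversal_Un[OF f gV this] have "\<exists>h. transversal V (A \<union> (I - A)) h" by blast
    moreover have "A \<union> (I - A) = I" using A by auto
    ultimately show False using noT by simp
  qed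
  from dominated_subfamily[OF _ this] fin obtain S D where SD: "S \<subseteq> I - A" "S \<noteq> {}" "finite D"
    "D \<subseteq> \<Union>(W ` S)" "\<Union>(W ` S) \<subseteq> nbh D"
    "card D + 2 \<le> 2 * card S \<and> flexible W S D \<or> card D + 3 \<le> 2 * card S" by blast
  have "flexible W S D \<Longrightarrow> flexible V S D"
    by (rule flexible_mono) (auto simp: W_def)
  then show ?thesis using SD by (intro exI[of _ S] exI[of _ D]) (auto simp: W_def)
qed

end

section \<open>Independent transversals in graphs of bounded degree\<close>

locale bounded_degree_partition = irreflexive_graph adj
  for adj :: "'v \<Rightarrow> 'v \<Rightarrow> bool" +
  fixes I :: "'i set" and V :: "'i \<Rightarrow> 'v set" and t d m :: nat
  assumes fin_I: "finite I"
    and fin_V: "\<And>i. i \<in> I \<Longrightarrow> finite (V i)"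
    and card_V: "\<And>i. i \<in> I \<Longrightarrow> card (V i) = t"
    and disj_V: "\<And>i k. i \<in> I \<Longrightarrow> k \<in> I \<Longrightarrow> i \<noteq> k \<Longrightarrow> V i \<inter> V k = {}"
    and degree: "\<And>x. x \<in> \<Union>(V ` I) \<Longrightarrow> card {y \<in> \<Union>(V ` I). adj x y} \<le> d"
    and m_pos: "m > 0"
    and card_I: "card I \<le> 2 * m + 1"
    and large: "2 * m * d < m * t + d"
begin

section \<open>Numerical bounds and degree counting\<close>

lemma finite_union: "S \<subseteq> I \<Longrightarrow> finite (\<Union>(V ` S))"
  using fin_I fin_V by (meson finite_UN finite_subset subsetD)

lemma finite_vertices: "U \<subseteq> \<Union>(V ` I) \<Longrightarrow> finite U"
  using finite_union[of I] finite_subset by blast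

lemma card_classes: "S \<subseteq> I \<Longrightarrow> card (\<Union>(V ` S)) = card S * t"
proof -
  assume S: "S \<subseteq> I"
  then have "\<forall>i\<in>S. \<forall>k\<in>S. i \<noteq> k \<longrightarrow> V i \<inter> V k = {}" using disj_V by (meson subsetD)
  then have "card (\<Union>(V ` S)) = (\<Sum>i\<in>S. card (V i))"
    using S fin_V finite_subset[OF S fin_I] by (intro card_UN_disjoint) auto
  also have "\<dots> = (\<Sum>i\<in>S. t)" using S card_V by (intro sum.cong) auto
  finally show ?thesis by simp
qed

text \<open>By \<open>large\<close>, \<open>t\<close> exceeds (2 - 1/m) d, and 2 - 1/s increases
  with s.\<close>

lemma size_small: "0 < s \<Longrightarrow> s \<le> m \<Longrightarrow> 2 * s * d < s * t + d"
proof -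
  assume s: "0 < s" "s \<le> m"
  have "m * (2 * s * d) + s * d = s * (2 * m * d) + s * d" by simp
  also have "\<dots> < s * (m * t + d) + s * d" using large s by simp
  also have "\<dots> \<le> m * (s * t + d) + s * d" using s by (simp add: algebra_simps)
  finally show ?thesis using m_pos by (metis add_less_cancel_right nat_mult_less_cancel1)
qed

text \<open>By \<open>large\<close>, \<open>t\<close> exceeds (2 - 1/m) d, which is at least (2 -
  2/s) d because s is at most 2m.\<close>

lemma size_large: "0 < s \<Longrightarrow> s \<le> 2 * m \<Longrightarrow> 2 * s * d < s * t + 2 * d"
proof -
  assume s: "0 < s" "s \<le> 2 * m"
  have "m * (2 * s * d) = s * (2 * m * d)" by simp
  also have "\<dots> < s * (m * t + d)" using large s by simp
  also have "\<dots> \<le> m * (s * t + 2 * d)" using s by (simp add: algebra_simps)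
  finally show ?thesis using m_pos by (metis nat_mult_less_cancel1)
qed

text \<open>As \<open>U\<close> and \<open>U'\<close> are disjoint, they share the at most
  \<open>d\<close> edges at each vertex of \<open>Z\<close>.\<close>

lemma double_count:
  assumes Z: "finite Z" "Z \<subseteq> \<Union>(V ` I)" "Z' \<subseteq> Z"
    and U: "U \<subseteq> \<Union>(V ` I)" "U' \<subseteq> \<Union>(V ` I)" "U \<inter> U' = {}"
  shows "card (nbh Z \<inter> U) + card (nbh Z' \<inter> U') \<le> card Z * d"
proof -
  have b: "card (nbh Y \<inter> T) \<le> (\<Sum>x\<in>Z. card ({y. adj x y} \<inter> T))" if "Y \<subseteq> Z" "T \<subseteq> \<Union>(V ` I)" for Y T
  proof -
    have "card (nbh Y \<inter> T) \<le> card (\<Union>x\<in>Z. {y. adj x y} \<inter> T)"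
      using that Z(1) by (intro card_mono finite_UN_I finite_vertices) (auto simp: nbh_def)
    also have "\<dots> \<le> (\<Sum>x\<in>Z. card ({y. adj x y} \<inter> T))" using Z(1) by (rule card_UN_le)
    finally show ?thesis .
  qed
  have "card (nbh Z \<inter> U) + card (nbh Z' \<inter> U')
      \<le> (\<Sum>x\<in>Z. card ({y. adj x y} \<inter> U)) + (\<Sum>x\<in>Z. card ({y. adj x y} \<inter> U'))"
    using b[of Z U] b[of Z' U'] Z U by (simp add: add_mono)
  also have "\<dots> = (\<Sum>x\<in>Z. card ({y. adj x y} \<inter> U) + card ({y. adj x y} \<inter> U'))"
    by (simp add: sum.distrib)
  also have "\<dots> \<le> (\<Sum>x\<in>Z. d)"
  proof (rule sum_mono)
    fix x assume "x \<in> Z"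
    have "card ({y. adj x y} \<inter> U) + card ({y. adj x y} \<inter> U') = card (({y. adj x y} \<inter> U) \<union> ({y. adj x y} \<inter> U'))"
      using U by (intro card_Un_disjoint[symmetric] finite_vertices) auto
    also have "\<dots> \<le> card {y \<in> \<Union>(V ` I). adj x y}"
      using U by (intro card_mono finite_vertices) auto
    also have "\<dots> \<le> d" using degree \<open>x \<in> Z\<close> Z by blast
    finally show "card ({y. adj x y} \<inter> U) + card ({y. adj x y} \<inter> U') \<le> d" .
  qed
  finally show ?thesis by simp
qed

section \<open>Blocks and the descent on undominated vertices\<close>

definition undominated :: "'i set \<Rightarrow> 'v set \<Rightarrow> 'v \<Rightarrow> 'v set" where
  "undominated S D v = \<Union>(V ` S) - nbh (insert v D)"

definition block :: "'i set \<Rightarrow> 'v set \<Rightarrow> 'v \<Rightarrow> bool" where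
  "block S D v \<longleftrightarrow> S \<subseteq> I \<and> S \<noteq> {} \<and> finite D \<and> D \<subseteq> \<Union>(V ` S) \<and>
     (\<exists>i \<in> I - S. v \<in> V i) \<and> v \<notin> nbh D"

abbreviation good :: "'i set \<Rightarrow> 'v set \<Rightarrow> 'v \<Rightarrow> bool" where
  "good S D v \<equiv> block S D v \<and> card D + 2 \<le> 2 * card S \<and> flexible V S D"

lemma block_vertices:
  assumes "block S D v"
  shows "insert v D \<subseteq> \<Union>(V ` I)" "\<Union>(V ` S) \<subseteq> \<Union>(V ` I)"
proof -
  show S: "\<Union>(V ` S) \<subseteq> \<Union>(V ` I)" using assms unfolding block_def by blast
  have "D \<subseteq> \<Union>(V ` S)" "v \<in> \<Union>(V ` I)" using assms unfolding block_def by blast+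
  then show "insert v D \<subseteq> \<Union>(V ` I)" using S by blast
qed

lemma block_card: "block S D v \<Longrightarrow> 0 < card S \<and> card S \<le> 2 * m"
proof -
  assume b: "block S D v"
  then have "S \<subset> I" by (auto simp: block_def)
  then have "card S < card I" using fin_I by (simp add: psubset_card_mono)
  moreover have "0 < card S" using b finite_subset[OF _ fin_I] by (simp add: block_def card_gt_0_iff)
  ultimately show ?thesis using card_I by simp
qed

lemma block_count:
  assumes "block S D v"
  shows "card S * t \<le> card (undominated S D v) + (card D + 1) * d"
proof -
  have S: "S \<subseteq> I" and D: "finite D" "D \<subseteq> \<Union>(V ` S)" using assms by (auto simp: block_def)
  have "card S * t = card (\<Union>(V ` S))" using card_classes S by simp
  also have "\<dots> = card (undominated S D v \<union> (nbh (insert v D) \<inter> \<Union>(V ` S)))"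
    by (rule arg_cong[of _ _ card]) (auto simp: undominated_def)
  also have "\<dots> \<le> card (undominated S D v) + card (nbh (insert v D) \<inter> \<Union>(V ` S))" by (rule card_Un_le)
  also have "card (nbh (insert v D) \<inter> \<Union>(V ` S)) + card (nbh {} \<inter> {}) \<le> card (insert v D) * d"
    using D block_vertices[OF assms] by (intro double_count) auto
  then have "card (nbh (insert v D) \<inter> \<Union>(V ` S)) \<le> card (insert v D) * d" by simp
  also have "card (insert v D) * d \<le> (card D + 1) * d"
    using D by (simp add: card_insert_if)
  finally show ?thesis by simp
qed

text \<open>A vertex \<open>u\<close> of \<open>S\<close> left undominated by \<open>D\<close> and \<open>v\<close> extends to a partial transversal inside
  \<open>D \<union> {u, v}\<close>, and \<open>u\<close> becomes \<open>v'\<close>. The vertices of \<open>S'\<close> that \<open>D'\<close> and \<open>u\<close> leave undominated are adjacent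
  to \<open>D \<union> {v}\<close>, whose degrees are thus shared between \<open>S\<close> and \<open>S'\<close>. If there is no such \<open>u\<close>, a vertex of \<open>S\<close>
  dominated by \<open>v\<close> but not by \<open>D\<close> takes its place, and \<open>v\<close> is left out of the partial transversal.\<close>

lemma next_block:
  assumes noT: "\<nexists>f. transversal V I f" and g: "good S D v"
  shows "\<exists>S' D' v'. block S' D' v' \<and>
    (card D' + 2 \<le> 2 * card S' \<and> flexible V S' D' \<or> card D' + 3 \<le> 2 * card S') \<and>
    card (undominated S' D' v') + card S * t + d \<le> card (undominated S D v) + 2 * card S * d \<and>
    card S' + card S \<le> card I \<and>
    (undominated S D v \<noteq> {} \<longrightarrow> card S' + card S < card I)"
proof -
  from g have S: "S \<subseteq> I" "S \<noteq> {}" and D: "finite D" "D \<subseteq> \<Union>(V ` S)" "card D + 2 \<le> 2 * card S"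
    and flex: "flexible V S D" and vD: "v \<notin> nbh D" by (auto simp: block_def)
  from g obtain iv where iv: "iv \<in> I" "iv \<notin> S" "v \<in> V iv" by (auto simp: block_def)
  have extend: "\<exists>f. transversal V S f \<and> f i = u \<and> f ` (S - {i}) \<subseteq> D" if "i \<in> S" "u \<in> V i" "u \<notin> nbh D" for i u
  proof -
    from flex that obtain h where h: "transversal (\<lambda>i. V i \<inter> D) (S - {i}) h" by (auto simp: flexible_def)
    then have hD: "h k \<in> D" if "k \<in> S - {i}" for k using that by (auto simp: transversal_def)
    have "transversal V (S - {i}) h" by (rule transversal_mono[OF h]) auto
    moreover have "\<not> adj u (h k)" if "k \<in> S - {i}" for k
      using not_adj_nbh[OF hD[OF that] \<open>u \<notin> nbh D\<close>] by blast
    ultimately have "transversal V (insert i (S - {i})) (h(i := u))"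
      using \<open>u \<in> V i\<close> by (intro transversal_insert) auto
    moreover have "insert i (S - {i}) = S" using that by auto
    moreover have "(h(i := u)) ` (S - {i}) \<subseteq> D" using hD by auto
    ultimately show ?thesis by (intro exI[of _ "h(i := u)"]) auto
  qed
  \<comment> \<open>\<open>A\<close> will be \<open>S\<close>, or \<open>S\<close> with the class of
    \<open>v\<close>; \<open>i\<close> is the class of the vertex that becomes \<open>v'\<close>. In
    the second case \<open>S'\<close> also misses the class of \<open>v\<close>, which makes the
    last inequality strict.\<close>
  have main: ?thesis
    if A: "A \<subseteq> I" "S \<subseteq> A" and i: "i \<in> A" and f: "transversal V A f" and fD: "f ` (A - {i}) \<subseteq> insert v D"
      and strict: "undominated S D v \<noteq> {} \<longrightarrow> S \<noteq> A" for A i f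
  proof -
    from dominated_complement[OF fin_I noT f A(1)] obtain S' D' where
      S': "S' \<subseteq> I - A" "S' \<noteq> {}" and D': "finite D'" "D' \<subseteq> \<Union>(V ` S')" "D' \<inter> nbh (f ` A) = {}"
        "\<Union>(V ` S') \<subseteq> nbh D' \<union> nbh (f ` A)"
      and alt: "card D' + 2 \<le> 2 * card S' \<and> flexible V S' D' \<or> card D' + 3 \<le> 2 * card S'"
      by (elim exE conjE) (rule that)
    have fi: "f i \<in> V i" using f i by (auto simp: transversal_def)
    have "f i \<notin> nbh D'" using nbh_disjoint[OF D'(3)] i by blast
    moreover have "i \<in> I - S'" "S' \<subseteq> I" using S' i A by auto
    ultimately have block: "block S' D' (f i)"
      using S'(2) D'(1,2) fi unfolding block_def by blast
    define U where "U = undominated S' D' (f i)"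
    have US': "U \<subseteq> \<Union>(V ` S')" by (auto simp: U_def undominated_def)
    \<comment> \<open>What \<open>D'\<close> and \<open>f i\<close> leave undominated is dominated
      by the other chosen vertices, all of which lie in \<open>insert v D\<close>.\<close>
    have "U \<subseteq> nbh (f ` (A - {i}))"
    proof
      fix x assume x: "x \<in> U"
      then have "x \<notin> nbh D'" "\<not> adj (f i) x" by (auto simp: U_def undominated_def nbh_def)
      moreover have "x \<in> nbh D' \<union> nbh (f ` A)" using x US' D'(4) by blast
      ultimately obtain k where "k \<in> A" "k \<noteq> i" "adj (f k) x" unfolding nbh_def by blast
      then show "x \<in> nbh (f ` (A - {i}))" unfolding nbh_def by blast
    qed
    then have U: "nbh (f ` (A - {i})) \<inter> U = U" by (rule Int_absorb1)
    have "S \<inter> S' = {}" using S' A by auto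
    have S'I: "S' \<subseteq> I" using S' by auto
    have "V k \<inter> V l = {}" if "k \<in> S" "l \<in> S'" for k l
      using that \<open>S \<inter> S' = {}\<close> S S'I by (intro disj_V) auto
    then have disj: "\<Union>(V ` S) \<inter> U = {}" using US' by blast
    have "card (nbh (insert v D) \<inter> \<Union>(V ` S)) + card (nbh (f ` (A - {i})) \<inter> U) \<le> card (insert v D) * d"
    proof (rule double_count[OF _ _ fD])
      show "U \<subseteq> \<Union>(V ` I)" using US' S'I by blast
    qed (use D disj block_vertices[of S D v] g in auto)
    then have le: "card (nbh (insert v D) \<inter> \<Union>(V ` S)) + card U \<le> card (insert v D) * d" using U by simp
    have "card (insert v D) + 1 \<le> 2 * card S" using D by (simp add: card_insert_if)
    then have "(card (insert v D) + 1) * d \<le> 2 * card S * d" by (rule mult_le_mono1)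
    then have le2: "card (insert v D) * d + d \<le> 2 * card S * d" by simp
    have "card S * t = card (undominated S D v \<union> (nbh (insert v D) \<inter> \<Union>(V ` S)))"
      unfolding card_classes[OF S(1), symmetric]
      by (rule arg_cong[of _ _ card]) (auto simp: undominated_def)
    also have "\<dots> \<le> card (undominated S D v) + card (nbh (insert v D) \<inter> \<Union>(V ` S))" by (rule card_Un_le)
    finally have count: "card U + card S * t + d \<le> card (undominated S D v) + 2 * card S * d"
      using le le2 by simp
    have "card S' + card S = card (S' \<union> S)"
      using finite_subset[OF S'I fin_I] finite_subset[OF S(1) fin_I] \<open>S \<inter> S' = {}\<close>
      by (intro card_Un_disjoint[symmetric]) auto
    moreover have "card (S' \<union> S) \<le> card I" using S S'I fin_I by (intro card_mono) auto
    moreover have "card (S' \<union> S) < card I" if "undominated S D v \<noteq> {}"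
    proof -
      have "S \<noteq> A" using strict that by blast
      then have "S' \<union> S \<subset> I" using S S' A by blast
      then show ?thesis using fin_I by (rule psubset_card_mono[rotated])
    qed
    ultimately have "card S' + card S \<le> card I \<and> (undominated S D v \<noteq> {} \<longrightarrow> card S' + card S < card I)" by auto
    then show ?thesis using block alt count unfolding U_def by blast
  qed
  show ?thesis
  proof (cases "undominated S D v = {}")
    case True
    have bc: "0 < card S" "card S \<le> 2 * m" using block_card g by auto
    \<comment> \<open>The at most 2|S| - 2 vertices of \<open>D\<close> have too small a degree sum
      to dominate \<open>S\<close> without \<open>v\<close>.\<close>
    have "\<not> \<Union>(V ` S) \<subseteq> nbh D"
    proof
      assume "\<Union>(V ` S) \<subseteq> nbh D"
      then have "nbh D \<inter> \<Union>(V ` S) = \<Union>(V ` S)" by (rule Int_absorb1)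
      moreover have "card (nbh D \<inter> \<Union>(V ` S)) + card (nbh {} \<inter> {}) \<le> card D * d"
        using D block_vertices[of S D v] g by (intro double_count) auto
      ultimately have "card S * t \<le> card D * d" using card_classes[OF S(1)] by simp
      moreover have "(card D + 2) * d \<le> 2 * card S * d" using D(3) by (rule mult_le_mono1)
      ultimately show False using size_large[OF bc] by simp
    qed
    then obtain z i where z: "i \<in> S" "z \<in> V i" "z \<notin> nbh D" by blast
    from extend[OF z] obtain f where f: "transversal V S f" "f i = z" "f ` (S - {i}) \<subseteq> D" by blast
    show ?thesis by (rule main[of S i f]) (use S f z True in auto)
  next
    case False
    then obtain u i where u: "i \<in> S" "u \<in> V i" "u \<notin> nbh (insert v D)" by (auto simp: undominated_def)
    then have "u \<notin> nbh D" by (auto simp: nbh_def)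
    from extend[OF u(1,2) this] obtain f where f: "transversal V S f" "f i = u" "f ` (S - {i}) \<subseteq> D" by blast
    have nadj: "\<not> adj v (f k)" if "k \<in> S" for k
    proof (cases "k = i")
      case True then show ?thesis using u f by (auto simp: nbh_def)
    next
      case False
      then have "f k \<in> D" using f that by auto
      then show ?thesis using not_adj_nbh vD by blast
    qed
    have "transversal V (insert iv S) (f(iv := v))"
      by (rule transversal_insert[OF f(1) iv(3)]) (use nadj in blast)
    moreover have "(f(iv := v)) ` (insert iv S - {i}) \<subseteq> insert v D" using f(3) iv by auto
    ultimately show ?thesis
      by (intro main[of "insert iv S" i "f(iv := v)"]) (use iv S u in auto)
  qed
qed

text \<open>Each passage to a next block \<open>S'\<close> lowers the
  number of undominated vertices by \<open>|S| t - (2 |S| - 1) d\<close>, which is positive for \<open>|S| \<le> m\<close>, and two consecutive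
  passages with \<open>|S| + |S'| \<le> 2 m\<close> lower it by \<open>(|S| + |S'|) t - 2 (|S| + |S'| - 1) d > 0\<close>. Hence a minimal good
  block with \<open>|S| \<le> m\<close> leads, in one or two passages, to a smaller one. The alternative \<open>|D| + 3 \<le> 2 |S|\<close> does not occur
  on the way, as it leaves too many vertices undominated.\<close>

theorem independent_transversal: "\<exists>f. transversal V I f"
proof (rule ccontr)
  assume noT: "\<nexists>f. transversal V I f"
  let ?gap = "\<lambda>S D v. card (undominated S D v)"
  have goodI: "good S D v" if b: "block S D v" and gap: "?gap S D v < d"
    and alt: "card D + 2 \<le> 2 * card S \<and> flexible V S D \<or> card D + 3 \<le> 2 * card S"
    and s: "card S \<le> m \<or> ?gap S D v + 2 * card S * d < card S * t + 2 * d" for S D v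
  proof -
    have bc: "0 < card S" "card S \<le> 2 * m" using block_card b by auto
    have "\<not> card D + 3 \<le> 2 * card S"
    proof
      assume "card D + 3 \<le> 2 * card S"
      then have "(card D + 3) * d \<le> 2 * card S * d" by (rule mult_le_mono1)
      then have "card S * t + 2 * d \<le> ?gap S D v + 2 * card S * d"
        using block_count[OF b] by (simp add: add_mult_distrib)
      then show False using s size_small[OF bc(1)] gap by auto
    qed
    then show ?thesis using b alt by blast
  qed
  have good_gap: "card S * t + d \<le> ?gap S D v + 2 * card S * d" if "good S D v" for S D v
  proof -
    have "(card D + 2) * d \<le> 2 * card S * d" using that by (intro mult_le_mono1) auto
    then show ?thesis using block_count[of S D v] that by (simp add: add_mult_distrib)
  qed
  obtain i0 where i0: "i0 \<in> I" using noT by (auto simp: transversal_def)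
  have "t > 0"
  proof (rule ccontr)
    assume "\<not> t > 0"
    then have "2 * m * d < d" using large by simp
    moreover have "d \<le> 2 * m * d" using m_pos by simp
    ultimately show False by simp
  qed
  then obtain v0 where v0: "v0 \<in> V i0" using card_V[OF i0] by (metis card.empty equals0I less_irrefl)
  \<comment> \<open>The descent starts from a single vertex \<open>v0\<close>, whose block leaves
    nothing undominated.\<close>
  have "transversal V {i0} (\<lambda>_. v0)" using v0 adj_irrefl by (auto simp: transversal_def)
  moreover have "{i0} \<subseteq> I" using i0 by simp
  ultimately have "\<exists>S D. S \<subseteq> I - {i0} \<and> S \<noteq> {} \<and> finite D \<and> D \<subseteq> \<Union>(V ` S) \<and> D \<inter> nbh {v0} = {} \<and>
      \<Union>(V ` S) \<subseteq> nbh D \<union> nbh {v0} \<and>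
      (card D + 2 \<le> 2 * card S \<and> flexible V S D \<or> card D + 3 \<le> 2 * card S)"
    using dominated_complement[OF fin_I noT, of "{i0}" "\<lambda>_. v0"] by simp
  then obtain S D where
    SD: "S \<subseteq> I - {i0}" "S \<noteq> {}" "finite D" "D \<subseteq> \<Union>(V ` S)" "D \<inter> nbh {v0} = {}"
    "\<Union>(V ` S) \<subseteq> nbh D \<union> nbh {v0}"
    and alt: "card D + 2 \<le> 2 * card S \<and> flexible V S D \<or> card D + 3 \<le> 2 * card S"
    by (elim exE conjE) (rule that)
  have "v0 \<notin> nbh D" using nbh_disjoint[OF SD(5)] by blast
  moreover have "S \<subseteq> I" "i0 \<in> I - S" using SD(1) i0 by auto
  ultimately have b: "block S D v0" using SD(2-4) v0 unfolding block_def by blast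
  have "undominated S D v0 = {}" using SD(6) by (auto simp: undominated_def nbh_def)
  then have gap0: "?gap S D v0 = 0" by simp
  have bc: "0 < card S" "card S \<le> 2 * m" using block_card b by auto
  have "d > 0"
  proof (rule ccontr)
    assume "\<not> d > 0"
    then show False using block_count[OF b] gap0 bc \<open>t > 0\<close> by simp
  qed
  then have gd: "good S D v0" using goodI[OF b _ alt] gap0 size_large[OF bc] by simp
  from next_block[OF noT gd] obtain S1 D1 v1 where
    1: "block S1 D1 v1" "card D1 + 2 \<le> 2 * card S1 \<and> flexible V S1 D1 \<or> card D1 + 3 \<le> 2 * card S1"
      "?gap S1 D1 v1 + card S * t + d \<le> ?gap S D v0 + 2 * card S * d" "card S1 + card S \<le> card I"
    by (elim exE conjE) (rule that)
  \<comment> \<open>A good block with |S| at most m has a positive gap. Hence |S| > m, and the next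
    block has at most m classes.\<close>
  have "\<not> card S \<le> m" using good_gap[OF gd] size_small[OF bc(1)] gap0 by auto
  then have small1: "card S1 \<le> m" using 1(4) card_I by simp
  have gap1: "?gap S1 D1 v1 < d" using 1(3) gap0 size_large[OF bc] by simp
  define Q where "Q k \<longleftrightarrow> (\<exists>S D v. good S D v \<and> card S \<le> m \<and> ?gap S D v = k)" for k
  have Q1: "Q (?gap S1 D1 v1)" using goodI[OF 1(1) gap1 1(2)] small1 unfolding Q_def by blast
  then have "Q (LEAST k. Q k)" by (rule LeastI)
  then obtain S2 D2 v2 where g2: "good S2 D2 v2" and s2: "card S2 \<le> m" 
    and least: "?gap S2 D2 v2 = (LEAST k. Q k)" unfolding Q_def by blast
  have gap2: "?gap S2 D2 v2 < d" using Least_le[of Q, OF Q1] gap1 least by simp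
  have minimal: False if "good S D v" "card S \<le> m" "?gap S D v < ?gap S2 D2 v2" for S D v
    using that least not_less_Least[of "?gap S D v" Q] unfolding Q_def by auto
  have bc2: "0 < card S2" using block_card g2 by auto
  have ne2: "undominated S2 D2 v2 \<noteq> {}"
    using good_gap[OF g2] size_small[OF bc2 s2] by auto
  from next_block[OF noT g2] obtain S3 D3 v3 where
    3: "block S3 D3 v3" "card D3 + 2 \<le> 2 * card S3 \<and> flexible V S3 D3 \<or> card D3 + 3 \<le> 2 * card S3"
      "?gap S3 D3 v3 + card S2 * t + d \<le> ?gap S2 D2 v2 + 2 * card S2 * d"
      "undominated S2 D2 v2 \<noteq> {} \<longrightarrow> card S3 + card S2 < card I"
    by (elim exE conjE) (rule that)
  have less3: "?gap S3 D3 v3 < ?gap S2 D2 v2" using 3(3) size_small[OF bc2 s2] by simp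
  \<comment> \<open>Since the gap of \<open>S2\<close> is positive, the two blocks miss a class and
    have at most 2m classes together.\<close>
  have sum: "2 * (card S3 + card S2) * d < (card S3 + card S2) * t + 2 * d"
    using bc2 3(4) ne2 card_I by (intro size_large) auto
  have g3: "good S3 D3 v3"
  proof (rule goodI[OF 3(1) _ 3(2)])
    show "?gap S3 D3 v3 < d" using less3 gap2 by simp
    show "card S3 \<le> m \<or> ?gap S3 D3 v3 + 2 * card S3 * d < card S3 * t + 2 * d"
      using 3(3) gap2 sum by (simp add: algebra_simps)
  qed
  \<comment> \<open>Minimality forces |S3| > m, so the following block has at most m classes, and
    the two drops together bring its gap below that of \<open>S2\<close>.\<close>
  have large3: "\<not> card S3 \<le> m" using minimal[OF g3] less3 by blast
  from next_block[OF noT g3] obtain S4 D4 v4 where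
    4: "block S4 D4 v4" "card D4 + 2 \<le> 2 * card S4 \<and> flexible V S4 D4 \<or> card D4 + 3 \<le> 2 * card S4"
      "?gap S4 D4 v4 + card S3 * t + d \<le> ?gap S3 D3 v3 + 2 * card S3 * d" "card S4 + card S3 \<le> card I"
    by (elim exE conjE) (rule that)
  have s4: "card S4 \<le> m" using 4(4) large3 card_I by simp
  have less4: "?gap S4 D4 v4 < ?gap S2 D2 v2" using 3(3) 4(3) sum by (simp add: algebra_simps)
  have "good S4 D4 v4" using goodI[OF 4(1) _ 4(2)] less4 gap2 s4 by simp
  then show False using minimal s4 less4 by blast
qed

end

section \<open>Copies of complete graphs and stars\<close>

lemma contains_copy_iff:
  assumes H: "simple_graph H"
  shows "contains_copy G H \<longleftrightarrow>
    (\<exists>g. inj_on g (verts H) \<and> g ` verts H \<subseteq> verts G \<and> (\<forall>e\<in>edges H. g ` e \<in> edges G))"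
proof
  assume "contains_copy G H"
  then obtain H' f where H': "subgraph H' G" and f: "bij_betw f (verts H) (verts H')"
    and E: "edges H' = (\<lambda>e. f ` e) ` edges H"
    unfolding contains_copy_def isomorphic_def by (elim exE conjE) (rule that)
  then show "\<exists>g. inj_on g (verts H) \<and> g ` verts H \<subseteq> verts G \<and> (\<forall>e\<in>edges H. g ` e \<in> edges G)"
    unfolding subgraph_def bij_betw_def by (intro exI[of _ f]) auto
next
  assume "\<exists>g. inj_on g (verts H) \<and> g ` verts H \<subseteq> verts G \<and> (\<forall>e\<in>edges H. g ` e \<in> edges G)"
  then obtain g where g: "inj_on g (verts H)" "g ` verts H \<subseteq> verts G" "\<forall>e\<in>edges H. g ` e \<in> edges G"
    by (elim exE conjE) (rule that)
  let ?H' = "(g ` verts H, (\<lambda>e. g ` e) ` edges H)"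
  have sub: "e \<subseteq> verts H" "card e = 2" if "e \<in> edges H" for e using H that by (auto simp: simple_graph_def)
  have "card (g ` e) = 2" if "e \<in> edges H" for e
    using sub[OF that] g(1) by (metis card_image inj_on_subset)
  moreover have "g ` e \<subseteq> g ` verts H" if "e \<in> edges H" for e using sub(1)[OF that] by (rule image_mono)
  ultimately have "subgraph ?H' G" using g(2,3) unfolding subgraph_def simple_graph_def by (simp add: image_subset_iff)
  moreover have "isomorphic H ?H'"
    using inj_on_imp_bij_betw[OF g(1)] unfolding isomorphic_def by (intro exI[of _ g]) simp
  ultimately show "contains_copy G H" unfolding contains_copy_def by blast
qed

lemma simple_complete_graph: "simple_graph (complete_graph j)"
  by (auto simp: simple_graph_def complete_graph_def)

lemma simple_star: "simple_graph (star n)"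
  by (auto simp: simple_graph_def star_def)

lemma multipartite_edge_iff:
  "{u, v} \<in> edges (complete_multipartite j t) \<longleftrightarrow>
    u \<in> {..<j} \<times> {..<t} \<and> v \<in> {..<j} \<times> {..<t} \<and> fst u \<noteq> fst v"
  (is "_ \<longleftrightarrow> ?R u v")
proof -
  have "?R v u" if "?R u v" for u v using that by metis
  then show ?thesis unfolding complete_multipartite_def snd_conv mem_Collect_eq doubleton_eq_iff by blast
qed

text \<open>The \<open>j\<close> vertices of a complete subgraph lie in distinct parts, hence one in
  each part, and the copy amounts to a choice function \<open>f\<close>.\<close>

lemma contains_complete_graph_iff:
  "contains_copy (colour_class (complete_multipartite j t) c k) (complete_graph j) \<longleftrightarrow>
    (\<exists>f. (\<forall>i<j. f i < t) \<and> (\<forall>i<j. \<forall>l<j. i \<noteq> l \<longrightarrow> c {(i, f i), (l, f l)} = k))"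
  (is "?L \<longleftrightarrow> ?R")
proof
  assume ?L
  then obtain g where g: "g ` {..<j} \<subseteq> {..<j} \<times> {..<t}"
    and e: "\<And>e. e \<in> edges (complete_graph j) \<Longrightarrow> g ` e \<in> edges (colour_class (complete_multipartite j t) c k)"
    unfolding contains_copy_iff[OF simple_complete_graph]
    by (auto simp: complete_graph_def colour_class_def complete_multipartite_def)
  have ge: "fst (g a) \<noteq> fst (g b) \<and> c {g a, g b} = k" if "a < j" "b < j" "a \<noteq> b" for a b
  proof -
    have "{a, b} \<in> edges (complete_graph j)" using that by (auto simp: complete_graph_def)
    from e[OF this] have "{g a, g b} \<in> edges (complete_multipartite j t)" "c {g a, g b} = k"
      by (auto simp: colour_class_def)
    then show ?thesis by (simp add: multipartite_edge_iff)
  qed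
  have inj: "inj_on (fst \<circ> g) {..<j}" using ge by (auto simp: inj_on_def)
  moreover have "(fst \<circ> g) ` {..<j} \<subseteq> {..<j}" using g by (auto simp: image_subset_iff mem_Times_iff)
  ultimately have surj: "(fst \<circ> g) ` {..<j} = {..<j}" by (intro endo_inj_surj) auto
  \<comment> \<open>\<open>h\<close> maps a part to the index of the clique vertex in it.\<close>
  define h where "h = inv_into {..<j} (fst \<circ> g)"
  have h: "h i < j" "fst (g (h i)) = i" if "i < j" for i
    using that surj inv_into_into[of i "fst \<circ> g" "{..<j}"] f_inv_into_f[of i "fst \<circ> g" "{..<j}"]
    by (auto simp: h_def)
  have gh: "(i, snd (g (h i))) = g (h i)" if "i < j" for i using h[OF that] by (simp add: prod_eq_iff)
  have "snd (g (h i)) < t" if "i < j" for i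
    using g h[OF that] by (auto simp: image_subset_iff mem_Times_iff)
  moreover have "c {(i, snd (g (h i))), (l, snd (g (h l)))} = k" if "i < j" "l < j" "i \<noteq> l" for i l
  proof -
    have "h i \<noteq> h l" using h that by metis
    then show ?thesis using ge h that by (simp add: gh)
  qed
  ultimately show ?R by (intro exI[of _ "\<lambda>i. snd (g (h i))"]) auto
next
  assume ?R
  then obtain f where f: "\<And>i. i < j \<Longrightarrow> f i < t"
    "\<And>i l. i < j \<Longrightarrow> l < j \<Longrightarrow> i \<noteq> l \<Longrightarrow> c {(i, f i), (l, f l)} = k" by blast
  show ?L
    unfolding contains_copy_iff[OF simple_complete_graph]
  proof (intro exI conjI ballI)
    show "inj_on (\<lambda>i. (i, f i)) (verts (complete_graph j))" by (auto simp: inj_on_def)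
    show "(\<lambda>i. (i, f i)) ` verts (complete_graph j) \<subseteq> verts (colour_class (complete_multipartite j t) c k)"
      using f by (auto simp: complete_graph_def colour_class_def complete_multipartite_def)
    fix e assume "e \<in> edges (complete_graph j)"
    then obtain a b where ab: "e = {a, b}" "a < j" "b < j" "a \<noteq> b" by (auto simp: complete_graph_def)
    have "{(a, f a), (b, f b)} \<in> edges (complete_multipartite j t)"
      using ab f by (simp add: multipartite_edge_iff)
    then show "(\<lambda>i. (i, f i)) ` e \<in> edges (colour_class (complete_multipartite j t) c k)"
      using ab f by (simp add: colour_class_def)
  qed
qed

lemma contains_star_iff:
  "contains_copy (colour_class (complete_multipartite j t) c k) (star n) \<longleftrightarrow>
    (\<exists>v \<in> {..<j} \<times> {..<t}. n \<le> card {u \<in> {..<j} \<times> {..<t}. fst v \<noteq> fst u \<and> c {v, u} = k})"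
  (is "?L \<longleftrightarrow> (\<exists>v \<in> _. n \<le> card (?N v))")
proof
  assume ?L
  then obtain g where inj: "inj_on g {0..n}" and g: "g ` {0..n} \<subseteq> {..<j} \<times> {..<t}"
    and e: "\<And>e. e \<in> edges (star n) \<Longrightarrow> g ` e \<in> edges (colour_class (complete_multipartite j t) c k)"
    unfolding contains_copy_iff[OF simple_star]
    by (auto simp: star_def colour_class_def complete_multipartite_def)
  have "g i \<in> ?N (g 0)" if "i \<in> {1..n}" for i
  proof -
    have "{0, i} \<in> edges (star n)" using that by (auto simp: star_def)
    from e[OF this] have "{g 0, g i} \<in> edges (complete_multipartite j t)" "c {g 0, g i} = k"
      by (auto simp: colour_class_def)
    then show ?thesis by (simp add: multipartite_edge_iff)
  qed
  then have "g ` {1..n} \<subseteq> ?N (g 0)" by blast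
  then have "card (g ` {1..n}) \<le> card (?N (g 0))" by (intro card_mono) auto
  moreover have "card (g ` {1..n}) = n" using inj by (subst card_image) (auto simp: inj_on_def)
  moreover have "g 0 \<in> {..<j} \<times> {..<t}" using g by auto
  ultimately show "\<exists>v \<in> {..<j} \<times> {..<t}. n \<le> card (?N v)" by (intro bexI[of _ "g 0"]) simp_all
next
  assume "\<exists>v \<in> {..<j} \<times> {..<t}. n \<le> card (?N v)"
  then obtain v where v: "v \<in> {..<j} \<times> {..<t}" and "n \<le> card (?N v)" by blast
  then obtain B where B: "B \<subseteq> ?N v" "card B = n" "finite B" by (meson obtain_subset_with_card_n)
  obtain h where h: "bij_betw h {1..n} B" using ex_bij_betw_nat_finite_1[OF B(3)] B(2) by auto
  have hN: "h i \<in> ?N v" if "i \<in> {1..n}" for i using subsetD[OF B(1) bspec[OF bij_betwE[OF h] that]] .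
  have hne: "h i \<noteq> v" if "i \<in> {1..n}" for i using hN[OF that] by (metis (mono_tags, lifting) mem_Collect_eq)
  define g where "g i = (if i = 0 then v else h i)" for i
  show ?L
    unfolding contains_copy_iff[OF simple_star]
  proof (intro exI conjI ballI)
    have "inj_on g {1..n}" using bij_betw_imp_inj_on[OF h] by (rule inj_on_cong[THEN iffD2, rotated]) (simp add: g_def)
    moreover have "g 0 \<notin> g ` {1..n}"
    proof
      assume "g 0 \<in> g ` {1..n}"
      then obtain i where "i \<in> {1..n}" "g 0 = g i" by (rule imageE)
      then show False using hne[of i] by (simp add: g_def)
    qed
    ultimately have "inj_on g (insert 0 {1..n})" by simp
    moreover have "verts (star n) = insert 0 {1..n}" by (auto simp: star_def)
    ultimately show "inj_on g (verts (star n))" by simp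
    show "g ` verts (star n) \<subseteq> verts (colour_class (complete_multipartite j t) c k)"
    proof
      fix x assume "x \<in> g ` verts (star n)"
      then obtain i where i: "x = g i" "i \<le> n" by (force simp: star_def)
      show "x \<in> verts (colour_class (complete_multipartite j t) c k)"
        using i v hN[of i] by (cases "i = 0") (auto simp: g_def colour_class_def complete_multipartite_def)
    qed
    fix e assume "e \<in> edges (star n)"
    then obtain i where i: "e = {0, i}" "i \<in> {1..n}" by (auto simp: star_def)
    then have ge: "g ` e = {v, h i}" by (auto simp: g_def)
    have "{v, h i} \<in> edges (complete_multipartite j t)" using hN[OF i(2)] v by (simp add: multipartite_edge_iff)
    then show "g ` e \<in> edges (colour_class (complete_multipartite j t) c k)"
      using hN[OF i(2)] unfolding ge by (simp add: colour_class_def)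
  qed
qed

lemma arrows_if_large:
  assumes m: "m > 0" "j \<le> 2 * m + 1" and large: "2 * m * d < m * t + d"
  shows "arrows (complete_multipartite j t) (complete_graph j) (star (Suc d))"
  unfolding arrows_def
proof (intro allI disjCI)
  fix c
  assume "\<not> contains_copy (colour_class (complete_multipartite j t) c Blue) (star (Suc d))"
  then have deg: "card {u \<in> {..<j} \<times> {..<t}. fst v \<noteq> fst u \<and> c {v, u} = Blue} \<le> d"
    if "v \<in> {..<j} \<times> {..<t}" for v
    using that unfolding contains_star_iff by (meson not_less_eq_eq)
  define adj where "adj v u \<longleftrightarrow> fst v \<noteq> fst u \<and> c {v, u} = Blue" for v u :: "nat \<times> nat"
  have verts: "(\<Union>i<j. {i} \<times> {..<t}) = {..<j} \<times> {..<t}" by auto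
  interpret bounded_degree_partition adj "{..<j}" "\<lambda>i. {i} \<times> {..<t}" t d m
  proof
    show "adj y x" if "adj x y" for x y using that by (auto simp: adj_def insert_commute)
    show "\<not> adj x x" for x by (simp add: adj_def)
    show "card {y \<in> \<Union> ((\<lambda>i. {i} \<times> {..<t}) ` {..<j}). adj x y} \<le> d"
      if "x \<in> \<Union> ((\<lambda>i. {i} \<times> {..<t}) ` {..<j})" for x
      using deg[of x] that unfolding verts adj_def by simp
  qed (use m large in auto)
  obtain f where f: "transversal (\<lambda>i. {i} \<times> {..<t}) {..<j} f" using independent_transversal by blast
  have fi: "f i = (i, snd (f i))" "snd (f i) < t" if "i < j" for i
    using f that by (auto simp: transversal_def mem_Times_iff prod_eq_iff)
  have "c {(i, snd (f i)), (l, snd (f l))} = Red" if "i < j" "l < j" "i \<noteq> l" for i l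
  proof -
    have "\<not> adj (f i) (f l)" using f that by (auto simp: transversal_def)
    then have "c {f i, f l} \<noteq> Blue" using fi(1)[OF that(1)] fi(1)[OF that(2)] that by (metis adj_def fst_conv)
    then show ?thesis using fi(1)[OF that(1)] fi(1)[OF that(2)] colour.exhaust by metis
  qed
  then show "contains_copy (colour_class (complete_multipartite j t) c Red) (complete_graph j)"
    unfolding contains_complete_graph_iff using fi by (intro exI[of _ "\<lambda>i. snd (f i)"]) auto
qed

section \<open>The extremal colouring\<close>

text \<open>The extremal blue graph is a disjoint union of complete bipartite graphs, one per propositional
  variable, whose two sides are the two literals of the variable. The classes \<open>0, \<dots>, 2 m - 1\<close> form two
  halves of \<open>m\<close> clauses. In half \<open>h\<close> the clause \<open>i < m - 1\<close> contains the positive literal \<open>i + 1\<close> and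
  negative literals \<open>k \<le> i\<close>, and the clause \<open>m - 1\<close> only negative ones. Variable \<open>0\<close> is shared by the halves:
  its literals are \<open>(0, 0, False)\<close> and \<open>(1, 0, False)\<close>. This formula is unsatisfiable. The negative
  vertices of each half fill the slots \<open>0, 1, 2, \<dots>\<close> of consecutive literals with \<open>d\<close> slots each.\<close>

type_synonym literal = "nat \<times> nat \<times> bool"

fun opposite :: "literal \<Rightarrow> literal" where
  "opposite (h, k, b) = (if k = 0 then (1 - h, 0, b) else (h, k, \<not> b))"

definition slot :: "nat \<Rightarrow> nat \<Rightarrow> nat \<Rightarrow> nat \<times> nat \<Rightarrow> nat" where
  "slot m d t v = (if snd v < d then (m - 1) * d + snd v else fst v mod m * (t - d) + (snd v - d))"

definition literal :: "nat \<Rightarrow> nat \<Rightarrow> nat \<Rightarrow> nat \<times> nat \<Rightarrow> literal" where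
  "literal m d t v = (fst v div m,
     if snd v < d \<and> fst v mod m < m - 1 then (fst v mod m + 1, True) else (slot m d t v div d, False))"

context
  fixes m d t :: nat
  assumes m: "m > 0" and d: "d > 0" and small: "m * t + d \<le> 2 * m * d"
begin

private abbreviation "lit \<equiv> literal m d t"

text \<open>The vertices of a half beyond the first \<open>d\<close> of each class fit into the
  slots of the literals below \<open>m - 1\<close>; literal \<open>m - 1\<close> is kept for the
  first \<open>d\<close> vertices of the last clause.\<close>

lemma excess_bound: "m * (t - d) \<le> (m - 1) * d"
proof -
  have "m * t \<le> m * d + (m * d - d)" using small by (simp add: mult_2 add_mult_distrib)
  then show ?thesis by (simp add: diff_mult_distrib2 diff_mult_distrib)
qed

lemma slot_extra:
  assumes "d \<le> snd v" "snd v < t"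
  shows "slot m d t v < (fst v mod m + 1) * (t - d)"
  using assms by (simp add: slot_def)

lemma slot_extra_less: "slot m d t v < (m - 1) * d" if "d \<le> snd v" "snd v < t"
proof -
  have "(fst v mod m + 1) * (t - d) \<le> m * (t - d)" using m by (intro mult_le_mono1) (simp add: Suc_le_eq)
  then show ?thesis using slot_extra[OF that] excess_bound by linarith
qed

lemma slot_inj:
  assumes u: "snd u < t" "snd (snd (lit u)) = False" and v: "snd v < t" "snd (snd (lit v)) = False"
    and h: "fst (lit u) = fst (lit v)" and eq: "slot m d t u = slot m d t v"
  shows "u = v"
proof -
  \<comment> \<open>Among the first \<open>d\<close> vertices of a class, only those of the last
    clause are negative, and their slots lie above all others.\<close>
  have main: "fst w mod m = m - 1 \<and> (m - 1) * d \<le> slot m d t w"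
    if "snd w < d" "snd (snd (lit w)) = False" for w
  proof -
    have "fst w mod m < m" using m by simp
    then show ?thesis using that by (auto simp: literal_def slot_def split: if_splits)
  qed
  have same: "fst u div m = fst v div m" using h by (simp add: literal_def)
  show ?thesis
  proof (cases "snd u < d"; cases "snd v < d")
    assume "snd u < d" "snd v < d"
    then have "snd u = snd v" "fst u mod m = fst v mod m" using main[of u] main[of v] u v eq by (auto simp: slot_def)
    then show ?thesis using same by (metis div_mult_mod_eq prod_eq_iff)
  next
    assume "snd u < d" "\<not> snd v < d"
    then show ?thesis using main[of u] slot_extra_less[of v] u v eq by simp
  next
    assume "\<not> snd u < d" "snd v < d"
    then show ?thesis using main[of v] slot_extra_less[of u] u v eq by simp
  next
    assume a: "\<not> snd u < d" "\<not> snd v < d"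
    have r: "snd u - d < t - d" "snd v - d < t - d" using a u v by auto
    have e: "fst u mod m * (t - d) + (snd u - d) = fst v mod m * (t - d) + (snd v - d)"
      using eq a by (simp add: slot_def)
    have "fst u mod m = fst v mod m \<and> snd u - d = snd v - d"
      using arg_cong[OF e, of "\<lambda>x. x div (t - d)"] arg_cong[OF e, of "\<lambda>x. x mod (t - d)"] r by simp
    then show ?thesis using same a by (metis div_mult_mod_eq prod_eq_iff le_add_diff_inverse not_less)
  qed
qed

text \<open>This bounds the blue degrees. A positive literal occurs only among the first
  \<open>d\<close> vertices of one class; the vertices of a negative literal occupy distinct slots
  among its \<open>d\<close> slots.\<close>

lemma literal_class_card: "card {u. snd u < t \<and> lit u = l} \<le> d"
proof -
  obtain h k b where l: "l = (h, k, b)" by (cases l)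
  show ?thesis
  proof (cases b)
    case True
    have "{u. snd u < t \<and> lit u = l} \<subseteq> {h * m + (k - 1)} \<times> {..<d}"
    proof
      fix u assume "u \<in> {u. snd u < t \<and> lit u = l}"
      then have "fst u div m = h" "snd u < d" "fst u mod m + 1 = k"
        using True by (auto simp: l literal_def split: if_splits)
      moreover then have "fst u = h * m + (k - 1)" by (metis add_diff_cancel_right' div_mult_mod_eq)
      ultimately show "u \<in> {h * m + (k - 1)} \<times> {..<d}" by (simp add: mem_Times_iff)
    qed
    then show ?thesis using card_mono[of "{h * m + (k - 1)} \<times> {..<d}"] by fastforce
  next
    case False
    have "inj_on (slot m d t) {u. snd u < t \<and> lit u = l}"
      by (rule inj_onI, rule slot_inj) (use False in \<open>auto simp: l\<close>)
    moreover have "slot m d t ` {u. snd u < t \<and> lit u = l} \<subseteq> {k * d..<k * d + d}"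
    proof
      fix x assume "x \<in> slot m d t ` {u. snd u < t \<and> lit u = l}"
      then have "x div d = k" using False by (auto simp: l literal_def split: if_splits)
      then show "x \<in> {k * d..<k * d + d}" using d dividend_less_div_times[of d x] by auto
    qed
    ultimately have "card {u. snd u < t \<and> lit u = l} \<le> card {k * d..<k * d + d}"
      by (rule card_inj_on_le) simp
    then show ?thesis by simp
  qed
qed

text \<open>The vertices of clause i beyond the first \<open>d\<close> have slots below (i + 1)(t -
  d), and t - d is at most d.\<close>

lemma negative_literal_le:
  assumes "snd v < t" "lit v = (h, k, False)"
  shows "k \<le> fst v mod m"
proof (cases "snd v < d")
  case True
  then have k: "k = slot m d t v div d" "\<not> fst v mod m < m - 1"
    using assms by (auto simp: literal_def split: if_splits)
  have "slot m d t v div d = m - 1" using True d by (simp add: slot_def)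
  then show ?thesis using k by simp
next
  case False
  have "m * (t - d) \<le> m * d" using excess_bound by (meson diff_le_self le_trans mult_le_mono1)
  then have "t - d \<le> d" using m by simp
  then have "slot m d t v < (fst v mod m + 1) * d"
    using slot_extra[of v] False assms by (meson le_trans less_le_trans mult_le_mono2 not_less)
  then have "slot m d t v div d < fst v mod m + 1" by (simp add: less_mult_imp_div_less)
  then show ?thesis using assms False by (simp add: literal_def)
qed

definition literal_colouring :: "(nat \<times> nat) set \<Rightarrow> colour" where
  "literal_colouring e = (if \<exists>u v. e = {u, v} \<and> fst u < 2 * m \<and> fst v < 2 * m \<and> lit u = opposite (lit v)
     then Blue else Red)"

lemma opposite_opposite: "fst l \<le> 1 \<Longrightarrow> opposite (opposite l) = l"
  by (cases l) auto

lemma lit_half: "fst v < 2 * m \<Longrightarrow> fst (lit v) \<le> 1"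
  by (simp add: literal_def less_mult_imp_div_less less_Suc_eq_le[symmetric])

text \<open>\<open>opposite\<close> is an involution on the literals of the halves 0 and 1, so the
  order of the two ends does not matter.\<close>

lemma literal_colouring_Blue_iff:
  "literal_colouring {u, v} = Blue \<longleftrightarrow> fst u < 2 * m \<and> fst v < 2 * m \<and> lit u = opposite (lit v)"
proof -
  have sym: "lit y = opposite (lit x)" if "fst y < 2 * m" "lit x = opposite (lit y)" for x y
    using that opposite_opposite lit_half by metis
  show ?thesis (is "_ \<longleftrightarrow> ?R")
  proof
    assume "literal_colouring {u, v} = Blue"
    then have "\<exists>x y. {u, v} = {x, y} \<and> fst x < 2 * m \<and> fst y < 2 * m \<and> lit x = opposite (lit y)"
      unfolding literal_colouring_def by (metis (mono_tags, lifting) colour.distinct(1) if_not_P)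
    then obtain x y where xy: "{u, v} = {x, y}" "fst x < 2 * m" "fst y < 2 * m" "lit x = opposite (lit y)"
      by (elim exE conjE) (rule that)
    from xy(1) consider "u = x" "v = y" | "u = y" "v = x" by (auto simp: doubleton_eq_iff)
    then show ?R using xy sym[OF xy(3,4)] by cases auto
  next
    assume ?R
    then have "\<exists>x y. {u, v} = {x, y} \<and> fst x < 2 * m \<and> fst y < 2 * m \<and> lit x = opposite (lit y)" by blast
    then show "literal_colouring {u, v} = Blue" unfolding literal_colouring_def by (rule if_P)
  qed
qed

text \<open>Without variable 0, every clause i picks the positive literal i + 1, by induction: a
  negative literal k with 0 < k \<le> i contradicts the choice of clause k - 1. But the last clause
  has no positive literal.\<close>

lemma half_uses_root:
  assumes f: "\<And>i. i < 2 * m \<Longrightarrow> f i < t"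
    and ind: "\<And>i l. i < 2 * m \<Longrightarrow> l < 2 * m \<Longrightarrow> i \<noteq> l \<Longrightarrow> literal_colouring {(i, f i), (l, f l)} \<noteq> Blue"
    and h: "h \<le> 1"
  shows "\<exists>i < 2 * m. lit (i, f i) = (h, 0, False)"
proof (rule ccontr)
  assume no: "\<not> ?thesis"
  have hm: "h * m + i < 2 * m" if "i < m" for i
  proof -
    have "h * m \<le> 1 * m" using h by (rule mult_le_mono1)
    then show ?thesis using that by linarith
  qed
  have pos: "lit (h * m + i, f (h * m + i)) = (h, i + 1, True)" if "i < m" for i
    using that
  proof (induction i rule: less_induct)
    case (less i)
    let ?v = "(h * m + i, f (h * m + i))"
    have v: "fst ?v div m = h" "fst ?v mod m = i" using less.prems by auto
    show ?case
    proof (cases "snd (snd (lit ?v))")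
      case True
      then show ?thesis using v by (simp add: literal_def split: if_splits)
    next
      case False
      then obtain k where k: "lit ?v = (h, k, False)" using v by (auto simp: literal_def split: if_splits)
      then have "k \<le> i" using negative_literal_le[of ?v h k] f[OF hm[OF less.prems]] v by simp
      moreover have "k \<noteq> 0"
      proof
        assume "k = 0"
        with k hm[OF less.prems] show False using no by blast
      qed
      ultimately have k': "k - 1 < i" "k - 1 < m" "k - 1 + 1 = k" using less.prems by auto
      have "lit (h * m + (k - 1), f (h * m + (k - 1))) = (h, k, True)" using less.IH[OF k'(1,2)] k'(3) by metis
      then have "lit (h * m + (k - 1), f (h * m + (k - 1))) = opposite (lit ?v)"
        unfolding k using \<open>k \<noteq> 0\<close> by simp
      then have "literal_colouring {(h * m + (k - 1), f (h * m + (k - 1))), ?v} = Blue"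
        unfolding literal_colouring_Blue_iff fst_conv using hm[OF k'(2)] hm[OF less.prems] by blast
      moreover have "h * m + (k - 1) \<noteq> h * m + i" using k'(1) by simp
      ultimately show ?thesis using ind[OF hm[OF k'(2)] hm[OF less.prems]] by blast
    qed
  qed
  have "lit (h * m + (m - 1), f (h * m + (m - 1))) = (h, m - 1 + 1, True)" using m by (intro pos) simp
  moreover have "(h * m + (m - 1)) mod m = m - 1" using m by (subst mod_mult_self3) simp
  ultimately show False by (simp add: literal_def split: if_splits)
qed

lemma not_arrows_if_small:
  assumes j: "2 * m \<le> j"
  shows "\<not> arrows (complete_multipartite j t) (complete_graph j) (star (Suc d))"
proof
  assume "arrows (complete_multipartite j t) (complete_graph j) (star (Suc d))"
  then consider "contains_copy (colour_class (complete_multipartite j t) literal_colouring Red) (complete_graph j)"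
    | "contains_copy (colour_class (complete_multipartite j t) literal_colouring Blue) (star (Suc d))"
    unfolding arrows_def by blast
  then show False
  proof cases
    case 1
    then obtain f where f: "\<forall>i<j. f i < t" "\<forall>i<j. \<forall>l<j. i \<noteq> l \<longrightarrow> literal_colouring {(i, f i), (l, f l)} = Red"
      unfolding contains_complete_graph_iff by blast
    have f1: "f i < t" if "i < 2 * m" for i using f(1) that j by simp
    have f2: "literal_colouring {(i, f i), (l, f l)} \<noteq> Blue" if "i < 2 * m" "l < 2 * m" "i \<noteq> l" for i l
      using f(2)[rule_format, of i l] that j by simp
    have "\<exists>i<2 * m. lit (i, f i) = (0, 0, False)" by (rule half_uses_root[OF f1 f2]) simp_all
    then obtain a where a: "a < 2 * m" "lit (a, f a) = (0, 0, False)" by blast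
    have "\<exists>i<2 * m. lit (i, f i) = (1, 0, False)" by (rule half_uses_root[OF f1 f2]) simp_all
    then obtain b where b: "b < 2 * m" "lit (b, f b) = (1, 0, False)" by blast
    \<comment> \<open>The literals that the two halves use for the shared variable 0 are opposite,
      which yields a blue edge.\<close>
    have "a \<noteq> b" using a(2) b(2) by auto
    moreover have "literal_colouring {(a, f a), (b, f b)} = Blue"
      unfolding literal_colouring_Blue_iff a(2) b(2) using a(1) b(1) by simp
    ultimately show False using f2[OF a(1) b(1)] by blast
  next
    case 2
    then obtain v where "v \<in> {..<j} \<times> {..<t}"
      and deg: "Suc d \<le> card {u \<in> {..<j} \<times> {..<t}. fst v \<noteq> fst u \<and> literal_colouring {v, u} = Blue}"
      unfolding contains_star_iff by blast
    let ?L = "opposite (lit v)"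
    have "fst u < (fst ?L + 1) * m" if "lit u = ?L" for u
    proof -
      have "fst u div m = fst ?L" using arg_cong[OF that, of fst] by (simp add: literal_def)
      then show ?thesis using m dividend_less_div_times[of m "fst u"] by simp
    qed
    then have "{u. snd u < t \<and> lit u = ?L} \<subseteq> {..<(fst ?L + 1) * m} \<times> {..<t}"
      by (auto simp: mem_Times_iff)
    then have fin: "finite {u. snd u < t \<and> lit u = ?L}" by (rule finite_subset) simp
    have "lit u = ?L" if "literal_colouring {v, u} = Blue" for u
      using that unfolding insert_commute[of v u] literal_colouring_Blue_iff by blast
    then have "{u \<in> {..<j} \<times> {..<t}. fst v \<noteq> fst u \<and> literal_colouring {v, u} = Blue} \<subseteq> {u. snd u < t \<and> lit u = ?L}"
      by (auto simp: mem_Times_iff)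
    from card_mono[OF fin this] have "Suc d \<le> card {u. snd u < t \<and> lit u = ?L}" using deg by linarith
    then show False using literal_class_card[of ?L] by simp
  qed
qed

end

text \<open>Both bounds meet: arrowing holds exactly for m t > (2m - 1) d.\<close>

lemma multipartite_ramsey_eq:
  assumes m: "m > 0" "2 * m \<le> j" "j \<le> 2 * m + 1" and d: "d > 0"
  shows "multipartite_ramsey j (complete_graph j) (star (Suc d)) = enat ((2 * m - 1) * d div m + 1)"
proof -
  have iff: "arrows (complete_multipartite j t) (complete_graph j) (star (Suc d)) \<longleftrightarrow>
      (2 * m - 1) * d div m + 1 \<le> t" for t
  proof -
    have "arrows (complete_multipartite j t) (complete_graph j) (star (Suc d)) \<longleftrightarrow> 2 * m * d < m * t + d"
      using arrows_if_large[OF m(1,3)] not_arrows_if_small[OF m(1) d _ m(2)] by (meson not_less)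
    also have "\<dots> \<longleftrightarrow> (2 * m - 1) * d < t * m"
    proof -
      have "(2 * m - 1) * d + d = 2 * m * d" using m(1) by (simp add: add_mult_distrib diff_mult_distrib)
      then show ?thesis by (simp only: mult.commute[of t]) linarith
    qed
    also have "\<dots> \<longleftrightarrow> (2 * m - 1) * d div m < t" using m(1) by (simp add: div_less_iff_less_mult)
    finally show ?thesis by (simp add: Suc_le_eq)
  qed
  show ?thesis
    unfolding multipartite_ramsey_def iff
    by (intro antisym Inf_lower Inf_greatest) auto
qed

theorem theorem5:
  fixes n j :: nat
  assumes "n \<ge> 2" and "j \<ge> 2"
  shows "(even j \<longrightarrow> multipartite_ramsey j (complete_graph j) (star n) =
            enat (nat \<lfloor>2 * (real n - 1) * (real j - 1) / real j\<rfloor> + 1)) \<and>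
         (odd j \<longrightarrow> multipartite_ramsey j (complete_graph j) (star n) =
            enat (nat \<lfloor>2 * (real n - 1) * (real j - 2) / (real j - 1)\<rfloor> + 1))"
proof -
  define m d where "m = j div 2" and "d = n - 1"
  have m: "m > 0" "2 * m \<le> j" "j \<le> 2 * m + 1" using assms by (auto simp: m_def)
  have d: "d > 0" "n = Suc d" using assms by (auto simp: d_def)
  \<comment> \<open>Substituting j = 2m or j = 2m + 1 turns both formulas of the theorem into this
    quotient.\<close>
  have "real ((2 * m - 1) * d) / real m = 2 * (real n - 1) * (2 * real m - 1) / (2 * real m)"
    using m d by (simp add: of_nat_diff field_simps)
  then have "nat \<lfloor>2 * (real n - 1) * (2 * real m - 1) / (2 * real m)\<rfloor> = (2 * m - 1) * d div m"
    by (metis floor_divide_of_nat_eq nat_int)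
  moreover have "real j = 2 * real m" if "even j" using that by (simp add: m_def real_of_nat_div)
  moreover have "real j = 2 * real m + 1" if "odd j"
  proof -
    have "j = 2 * m + 1" using that by (simp add: m_def)
    then show ?thesis by simp
  qed
  ultimately show ?thesis using multipartite_ramsey_eq[OF m d(1)] d(2) by simp
qed

end
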